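(* Let $E:\mathbb{R}^n\to\mathbb{R}^n$ be monotone and Lipschitz continuous with constant $L>0$, and assume that $X^*=\{x\in\mathbb{R}^n: E(x)=0\}$ is nonempty. Let $\{x_\ell\}_{\ell\ge 0}$ be an infinite sequence generated by the projection-based subspace algorithm with the exact projection rule described in the context (in either its line-search version or its fixed-step version), and let $d_\ell=\operatorname{dist}(x_\ell,X^* )$. If there exist constants $\vartheta>0$ and $\delta>0$ such that $\vartheta\,\operatorname{dist}(x,X^* )\le\|E(x)\|$ for every $x\in\mathbb{R}^n$ with $\operatorname{dist}(x,X^* )<\delta$ (local error bound), then $d_\ell=o(\ell^{-1/2})$. Moreover, let $x^*\in X^*$ be the limit of $\{x_\ell\}_{\ell\ge 0}$ (the sequence converges to a point of $X^*$). If $E$ is continuously differentiable on an open neighborhood of $x^*$ and $\sigma_{\min}(J_E(x^* ))>0$, then there exist an index $\ell_0\ge0$, a constant $q\in(0,1)$ and a constant $M>0$ such that $$\|x_\ell-x^*\|\le Mq^{\,\ell-\ell_0},\qquad \|E(x_\ell)\|\le LMq^{\,\ell-\ell_0}\qquad\text{for all }\ell\ge\ell_0;$$ that is, $\{x_\ell\}_{\ell\ge0}$ converges $R$-linearly to the solution $x^*\in X^*$, and the residual sequence satisfies $\|E(x_\ell)\|=o(\ell^{-1})$.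
   Context: Setting. $\|\cdot\|$ is the Euclidean norm on $\mathbb{R}^n$. $E:\mathbb{R}^n\to\mathbb{R}^n$ is continuous and monotone, i.e. $(E(x_1)-E(x_2))^T(x_1-x_2)\ge 0$ for all $x_1,x_2\in\mathbb{R}^n$. $\operatorname{dist}(x,C)=\inf\{\|x-y\|:y\in C\}$; $P_C$ denotes the Euclidean projection onto a nonempty closed convex set $C$; $J_E$ is the Jacobian of $E$ and $\sigma_{\min}(\cdot)$ the smallest singular value. Parameters: $\Delta_a\in(0,1)$, $\rho\in(0,1)$, $\gamma>1$, $\mu_{\rm init}\in(0,1]$, $\zeta\in(0,1)$, $-\infty<\beta_{\min}\le\beta_{\max}<\infty$; $L$ is the Lipschitz constant of $E$. Algorithm (exact projection rule). Given $x_0\in\mathbb{R}^n$, set $p_0=p_0^{\rm sc}=-E(x_0)$. For $\ell=0,1,2,\dots$, as long as $E(x_\ell)\ne 0$ (the algorithm stops when $E(x_\ell)=0$, so an infinite sequence has $E(x_\ell)\neq0$ for all $\ell$): (1) Step size. One of two versions is used throughout. Line-search version: $\mu_\ell$ is the first trial value $\mu$, starting from $\mu=\mu_{\rm init}$ and updated after each rejection by $\mu\leftarrow\max\{\mu/\gamma,\mu_{\min}\}$, such that $(p_\ell^{\rm sc})^TE(x_\ell+\mu p_\ell^{\rm sc})\le-\rho\,\mu\|p_\ell^{\rm sc}\|^2$; here $0<\mu_{\min}\le\min\{\mu_{\rm init},\Delta_a/(L+\rho)\}$. Fixed-step version: $\mu_\ell=\alpha$ for all $\ell$, where $0<\alpha\le\min\{1,\Delta_a/(L+\rho)\}$.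 In both versions set $\bar x_\ell=x_\ell+\mu_\ell p_\ell^{\rm sc}$. (2) Projection. Set $x_{\ell+1}=P_{\overline H_\ell}(x_\ell)$ with $\overline H_\ell=\{x:(x-\bar x_\ell)^TE(\bar x_\ell)\le 0\}$; equivalently $x_{\ell+1}=x_\ell-\lambda_\ell E(\bar x_\ell)$ with $\lambda_\ell=(x_\ell-\bar x_\ell)^TE(\bar x_\ell)/\|E(\bar x_\ell)\|^2$. (3) Direction. If $E(x_{\ell+1})\neq 0$, compute $p_{\ell+1}$ and $p_{\ell+1}^{\rm sc}$ by the direction rule below. Direction rule at index $\ell\ge1$. Write $E_\ell=E(x_\ell)$, $p=p_{\ell-1}$ (the unscaled, angle-safeguarded previous direction), $s=\bar x_{\ell-1}-x_{\ell-1}$, $y=E(\bar x_{\ell-1})-E(x_{\ell-1})$. First $y$ is safeguarded: if $s^Ty=0$, replace $y$ by $y+\varphi s$ with some $0<\varphi\le\overline\varphi$; if then $y^Tp=0$, put $u=p-\frac{s^Tp}{\|s\|^2}s$ and replace $y$ by $y+\psi\|s\|u/\|u\|$ with some $0<\psi\le\overline\psi$ ($\overline\varphi,\overline\psi>0$ constants). One of the following families, with one coefficient formula, is fixed for the whole run; every coefficient is truncated to $[\beta_{\min},\beta_{\max}]$: (a) $p_\ell=-E_\ell+\beta_\ell p$, with $\beta_\ell$ one of $\frac{\|E_\ell\|^2}{\|E_{\ell-1}\|^2}$, $\frac{y^TE_\ell}{\|E_{\ell-1}\|^2}$, $\frac{y^TE_\ell}{y^Tp}$, $\frac{\|E_\ell\|^2}{y^Tp}$,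 $-\frac{E_\ell^Ty}{E_{\ell-1}^Tp}$, $\frac{E_\ell^T(y-2\frac{\|y\|^2}{y^Tp}p)}{y^Tp}$, $\frac{E_\ell^T(y-0.1\,p)}{y^Tp}$; (b) $p_\ell=-E_\ell+\beta^1_\ell p+\beta^2_\ell y$, with $(\beta^1_\ell,\beta^2_\ell)$ equal to $\left(\frac{y^TE_\ell}{\|E_{\ell-1}\|^2},-\frac{p^TE_\ell}{\|E_{\ell-1}\|^2}\right)$ or $\left(\frac{y^TE_\ell}{y^Tp},-\frac{p^TE_\ell}{y^Tp}\right)$; (c) $p_\ell=-E_\ell+\beta^3_\ell y+\beta^4_\ell s$, with $\beta^3_\ell=-\frac{s^TE_\ell}{y^Ts}$, $\beta^4_\ell=c_\ell\beta^3_\ell+\frac{y^TE_\ell}{y^Ts}$, where, for $\phi=\|y\|^2/(y^Ts)$, $c_\ell$ is one of $1+\phi$, $1+2\phi$, $1-\min\{1,\phi\}$; (d) $p_\ell=-E_\ell+\beta_\ell p+\beta^5_\ell h_\ell$, with $\beta_\ell$ one of the coefficients in (a), $h_\ell$ an auxiliary vector with $E_\ell^Th_\ell\ne0$, $\beta^5_\ell=-\frac{(\gamma_\ell-1)\|E_\ell\|^2+\beta_\ell E_\ell^Tp}{E_\ell^Th_\ell}$, $\gamma_\ell=\max\{\varsigma_1,\min\{\varsigma_2,\bar\gamma_\ell\}\}$, $0<\varsigma_1\le1<\varsigma_2$, and, for a constant $\overline\gamma>0$ and $R=\frac{E_\ell^Tp}{\|E_{\ell-1}\|\,\|p\|}$,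 $\bar\gamma_\ell$ one of $1\pm\overline\gamma|\beta_\ell R|$, $1\pm\overline\gamma\beta_\ell R$, $1\pm\overline\gamma|R|$, $1\pm\overline\gamma R$. If $p_\ell=0$, set $p_\ell=-E_\ell$. Angle safeguard: if the angle condition $\frac{p_\ell^TE_\ell}{\|p_\ell\|\|E_\ell\|}\le-\Delta_a$ fails, let $\sigma_1=\|E_\ell\|^2$, $\sigma_2=\|p_\ell\|^2$, $\sigma=E_\ell^Tp_\ell$, $w=\frac{\sigma_1\sigma_2-\sigma^2}{1-\Delta_a^2}$; replace $p_\ell$ by $p_\ell-\frac{\sigma+\Delta_a\sqrt w}{\sigma_1}E_\ell$ if $w>0$ and by $-E_\ell$ if $w=0$. (The resulting $p_\ell$ satisfies the angle condition.) Scaling: $p_\ell^{\rm sc}=\frac{\operatorname{mid}\{\zeta\|E_\ell\|,\|p_\ell\|,\|E_\ell\|\}}{\|p_\ell\|}p_\ell$, where $\operatorname{mid}$ is the median of three numbers; hence $\zeta\|E_\ell\|\le\|p_\ell^{\rm sc}\|\le\|E_\ell\|$. *)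

theory Defs
  imports "HOL-Analysis.Analysis" "HOL-Library.Landau_Symbols"
begin

section \<open>Singular values of a square real matrix\<close>

definition singular_values :: "real^'n^'n \<Rightarrow> real set" where
  "singular_values A =
     {sqrt c | c. \<exists>v. v \<noteq> 0 \<and> (transpose A ** A) *v v = c *\<^sub>R v}"

definition sigma_min :: "real^'n^'n \<Rightarrow> real" where
  "sigma_min A = Min (singular_values A)"

text \<open>The set is finite and nonempty, so that the minimum is meaningful.\<close>

lemma inner_gram: "w \<bullet> ((transpose A ** A) *v v) = (A *v w) \<bullet> (A *v v)"
  for A :: "real^'n^'n"
  by (metis dot_lmul_matrix matrix_vector_mul_assoc vector_transpose_matrix transpose_matrix_vector)

lemma finite_singular_values: "finite (singular_values A)"
proof -
  let ?B = "transpose A ** A"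
  define S where "S = {c. \<exists>v. v \<noteq> 0 \<and> ?B *v v = c *\<^sub>R v}"
  have "\<forall>c\<in>S. \<exists>v. v \<noteq> 0 \<and> ?B *v v = c *\<^sub>R v" by (auto simp: S_def)
  then obtain v where v: "\<And>c. c \<in> S \<Longrightarrow> v c \<noteq> 0" "\<And>c. c \<in> S \<Longrightarrow> ?B *v v c = c *\<^sub>R v c"
    by metis
  have orth: "v c \<bullet> v d = 0" if "c \<in> S" "d \<in> S" "c \<noteq> d" for c d
  proof -
    have "c * (v c \<bullet> v d) = d * (v c \<bullet> v d)"
      using inner_gram[of "v d" A "v c"] inner_gram[of "v c" A "v d"] v(2) that
      by (simp add: inner_commute)
    then show ?thesis using that(3) by simp
  qed
  have inj: "inj_on v S"
    by (rule inj_onI) (metis orth v(1) inner_eq_zero_iff)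
  have "pairwise orthogonal (v ` S)"
    using orth by (auto simp: pairwise_def orthogonal_def)
  then have "independent (v ` S)"
    using v(1) by (intro pairwise_orthogonal_independent) auto
  then have "finite S"
    using independent_imp_finite finite_imageD[OF _ inj] by blast
  moreover have "singular_values A = sqrt ` S"
    by (auto simp: singular_values_def S_def)
  ultimately show ?thesis by simp
qed

lemma singular_values_nonempty: "singular_values (A :: real^'n^'n) \<noteq> {}"
proof -
  let ?B = "transpose A ** A"
  have "continuous_on (sphere 0 1) (\<lambda>v. (norm (A *v v))\<^sup>2)"
    by (intro continuous_on_power continuous_on_norm linear_continuous_on
        matrix_vector_mul_bounded_linear)
  moreover have "sphere (0 :: real^'n) 1 \<noteq> {}" by simp
  ultimately obtain v :: "real^'n" where v: "norm v = 1"
    and min: "\<And>u. norm u = 1 \<Longrightarrow> (norm (A *v v))\<^sup>2 \<le> (norm (A *v u))\<^sup>2"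
    using continuous_attains_inf[OF compact_sphere, of 0 1 "\<lambda>v. (norm (A *v v))\<^sup>2"] by force
  define m where "m = (norm (A *v v))\<^sup>2"
  have psd: "m * (norm u)\<^sup>2 \<le> (norm (A *v u))\<^sup>2" for u
  proof (cases "u = 0")
    case False
    have "m \<le> (norm (A *v (u /\<^sub>R norm u)))\<^sup>2"
      unfolding m_def by (rule min) (use False in simp)
    also have "\<dots> = (norm (A *v u))\<^sup>2 / (norm u)\<^sup>2"
      by (simp add: matrix_vector_mult_scaleR divide_inverse power_mult_distrib power_inverse mult.commute)
    finally show ?thesis using False by (simp add: field_simps)
  qed simp
  define w where "w = ?B *v v - m *\<^sub>R v"
  define k where "k = (norm (A *v w))\<^sup>2 - m * (norm w)\<^sup>2"
  have k: "k \<ge> 0" using psd[of w] by (simp add: k_def)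
  have ww: "(A *v w) \<bullet> (A *v v) - m * (w \<bullet> v) = (norm w)\<^sup>2"
    unfolding inner_gram[symmetric] power2_norm_eq_inner
    by (simp add: w_def inner_diff_right)
  have quad: "0 \<le> t\<^sup>2 * k - 2 * t * (norm w)\<^sup>2" for t
  proof -
    have "0 \<le> (norm (A *v (v - t *\<^sub>R w)))\<^sup>2 - m * (norm (v - t *\<^sub>R w))\<^sup>2"
      using psd[of "v - t *\<^sub>R w"] by simp
    also have "\<dots> = t\<^sup>2 * k - 2 * t * ((A *v w) \<bullet> (A *v v) - m * (w \<bullet> v))
        + ((norm (A *v v))\<^sup>2 - m * (norm v)\<^sup>2)"
      unfolding power2_norm_eq_inner k_def
      by (simp add: matrix_vector_mult_diff_distrib matrix_vector_mult_scaleR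
          inner_diff_left inner_diff_right inner_commute power2_eq_square algebra_simps)
    finally show ?thesis unfolding ww by (simp add: m_def v)
  qed
  have "(norm w)\<^sup>2 = 0"
  proof (rule ccontr)
    assume "(norm w)\<^sup>2 \<noteq> 0"
    then have n: "(norm w)\<^sup>2 > 0" by simp
    define t where "t = (norm w)\<^sup>2 / (k + 1)"
    have t: "t > 0" using n k by (simp add: t_def)
    have "0 \<le> t * (t * k - 2 * (norm w)\<^sup>2)"
      using quad[of t] by (simp add: power2_eq_square algebra_simps)
    then have "2 * (norm w)\<^sup>2 \<le> t * k" using t by (simp add: zero_le_mult_iff)
    moreover have "t * k \<le> t * (k + 1)" using t by (simp add: algebra_simps)
    moreover have "t * (k + 1) = (norm w)\<^sup>2" using k by (simp add: t_def)
    ultimately show False using n by linarith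
  qed
  then have "?B *v v = m *\<^sub>R v" by (simp add: w_def)
  moreover have "v \<noteq> 0" using v by auto
  ultimately show ?thesis unfolding singular_values_def by blast
qed


section \<open>Problem data\<close>

definition monotone_operator :: "('a::real_inner \<Rightarrow> 'a) \<Rightarrow> bool" where
  "monotone_operator E \<longleftrightarrow> (\<forall>x\<^sub>1 x\<^sub>2. (E x\<^sub>1 - E x\<^sub>2) \<bullet> (x\<^sub>1 - x\<^sub>2) \<ge> 0)"

definition solution_set :: "('a \<Rightarrow> 'b::zero) \<Rightarrow> 'a set" where
  "solution_set E = {x. E x = 0}"

definition local_error_bound :: "('a::metric_space \<Rightarrow> 'b::real_normed_vector) \<Rightarrow> bool" where
  "local_error_bound E \<longleftrightarrow>
     (\<exists>\<theta>>0. \<exists>\<delta>>0. \<forall>x. infdist x (solution_set E) < \<delta> \<longrightarrow>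
        \<theta> * infdist x (solution_set E) \<le> norm (E x))"

definition continuously_differentiable_near :: "(real^'n \<Rightarrow> real^'m) \<Rightarrow> real^'n \<Rightarrow> bool" where
  "continuously_differentiable_near f a \<longleftrightarrow>
     (\<exists>U. open U \<and> a \<in> U \<and> (\<forall>x\<in>U. f differentiable (at x)) \<and>
          continuous_on U (\<lambda>x. jacobian f (at x)))"


section \<open>The projection-based subspace algorithm\<close>

text \<open>Conjugate gradient coefficients (Fletcher--Reeves, Polak--Ribiere--Polyak,
  Hestenes--Stiefel, Dai--Yuan, Liu--Storey, Hager--Zhang, Dai--Liao type).\<close>

datatype cg_coeff = FR | PRP | HS | DY | LS | HZ | DL

datatype three_term_coeff = TT_PRP | TT_HS

datatype qn_coeff = QN_one_plus | QN_one_plus_two | QN_one_minus_min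

datatype sign = Plus | Minus

datatype gamma_form = Abs_beta_R | Beta_R | Abs_R | Plain_R

datatype direction_family =
    CG cg_coeff
  | Three_Term three_term_coeff
  | Quasi_Newton qn_coeff
  | Auxiliary cg_coeff sign gamma_form

datatype step_version =
    Line_Search (mu_init: real) (ls_gamma: real) (mu_min: real)
  | Fixed_Step (fixed_alpha: real)

record alg_params =
  Delta_a :: real
  rho :: real
  zeta :: real
  beta_min :: real
  beta_max :: real
  phi_max :: real
  psi_max :: real
  varsigma1 :: real
  varsigma2 :: real
  gamma_bar :: real
  step_ver :: step_version
  dir_family :: direction_family

fun valid_step_version :: "real \<Rightarrow> real \<Rightarrow> real \<Rightarrow> step_version \<Rightarrow> bool" where
  "valid_step_version L \<Delta> \<rho> (Line_Search \<mu>\<^sub>0 \<gamma> \<mu>\<^sub>m) \<longleftrightarrow>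
     0 < \<mu>\<^sub>0 \<and> \<mu>\<^sub>0 \<le> 1 \<and> \<gamma> > 1 \<and> 0 < \<mu>\<^sub>m \<and> \<mu>\<^sub>m \<le> min \<mu>\<^sub>0 (\<Delta> / (L + \<rho>))"
| "valid_step_version L \<Delta> \<rho> (Fixed_Step \<alpha>) \<longleftrightarrow> 0 < \<alpha> \<and> \<alpha> \<le> min 1 (\<Delta> / (L + \<rho>))"

definition valid_params :: "real \<Rightarrow> alg_params \<Rightarrow> bool" where
  "valid_params L P \<longleftrightarrow>
     0 < Delta_a P \<and> Delta_a P < 1 \<and> 0 < rho P \<and> rho P < 1 \<and>
     0 < zeta P \<and> zeta P < 1 \<and> beta_min P \<le> beta_max P \<and>
     0 < phi_max P \<and> 0 < psi_max P \<and>
     0 < varsigma1 P \<and> varsigma1 P \<le> 1 \<and> 1 < varsigma2 P \<and> 0 < gamma_bar P \<and>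
     valid_step_version L (Delta_a P) (rho P) (step_ver P)"


subsection \<open>Step size\<close>

primrec trial_step :: "real \<Rightarrow> real \<Rightarrow> real \<Rightarrow> nat \<Rightarrow> real" where
  "trial_step \<mu>\<^sub>0 \<gamma> \<mu>\<^sub>m 0 = \<mu>\<^sub>0"
| "trial_step \<mu>\<^sub>0 \<gamma> \<mu>\<^sub>m (Suc k) = max (trial_step \<mu>\<^sub>0 \<gamma> \<mu>\<^sub>m k / \<gamma>) \<mu>\<^sub>m"

definition acceptable_step ::
    "('a::real_inner \<Rightarrow> 'a) \<Rightarrow> real \<Rightarrow> 'a \<Rightarrow> 'a \<Rightarrow> real \<Rightarrow> bool" where
  "acceptable_step E \<rho> x d \<mu> \<longleftrightarrow> d \<bullet> E (x + \<mu> *\<^sub>R d) \<le> - \<rho> * \<mu> * (norm d)\<^sup>2"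

fun step_size ::
    "('a::real_inner \<Rightarrow> 'a) \<Rightarrow> real \<Rightarrow> step_version \<Rightarrow> 'a \<Rightarrow> 'a \<Rightarrow> real \<Rightarrow> bool" where
  "step_size E \<rho> (Line_Search \<mu>\<^sub>0 \<gamma> \<mu>\<^sub>m) x d \<mu> \<longleftrightarrow>
     (\<exists>k. \<mu> = trial_step \<mu>\<^sub>0 \<gamma> \<mu>\<^sub>m k \<and> acceptable_step E \<rho> x d \<mu> \<and>
        (\<forall>j<k. \<not> acceptable_step E \<rho> x d (trial_step \<mu>\<^sub>0 \<gamma> \<mu>\<^sub>m j)))"
| "step_size E \<rho> (Fixed_Step \<alpha>) x d \<mu> \<longleftrightarrow> \<mu> = \<alpha>"


subsection \<open>Direction rule\<close>

text \<open>In this subsection \<open>e\<close> and \<open>e'\<close> are the values of the operator at the current and the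
  previous iterate, and \<open>p\<close> is the previous unscaled direction.\<close>

definition safeguarded_y :: "real \<Rightarrow> real \<Rightarrow> 'a::real_inner \<Rightarrow> 'a \<Rightarrow> 'a \<Rightarrow> 'a \<Rightarrow> bool" where
  "safeguarded_y \<phi>\<^sub>m \<psi>\<^sub>m p s y\<^sub>0 y \<longleftrightarrow>
     (\<exists>\<phi> \<psi>. 0 < \<phi> \<and> \<phi> \<le> \<phi>\<^sub>m \<and> 0 < \<psi> \<and> \<psi> \<le> \<psi>\<^sub>m \<and>
        (let y\<^sub>1 = (if s \<bullet> y\<^sub>0 = 0 then y\<^sub>0 + \<phi> *\<^sub>R s else y\<^sub>0);
             u = p - ((s \<bullet> p) / (norm s)\<^sup>2) *\<^sub>R s
         in y = (if y\<^sub>1 \<bullet> p = 0 then y\<^sub>1 + (\<psi> * norm s / norm u) *\<^sub>R u else y\<^sub>1)))"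

definition truncate :: "alg_params \<Rightarrow> real \<Rightarrow> real" where
  "truncate P b = max (beta_min P) (min (beta_max P) b)"

fun cg_beta :: "cg_coeff \<Rightarrow> 'a::real_inner \<Rightarrow> 'a \<Rightarrow> 'a \<Rightarrow> 'a \<Rightarrow> real" where
  "cg_beta FR e e' p y = (norm e)\<^sup>2 / (norm e')\<^sup>2"
| "cg_beta PRP e e' p y = (y \<bullet> e) / (norm e')\<^sup>2"
| "cg_beta HS e e' p y = (y \<bullet> e) / (y \<bullet> p)"
| "cg_beta DY e e' p y = (norm e)\<^sup>2 / (y \<bullet> p)"
| "cg_beta LS e e' p y = - (e \<bullet> y) / (e' \<bullet> p)"
| "cg_beta HZ e e' p y = (e \<bullet> (y - (2 * (norm y)\<^sup>2 / (y \<bullet> p)) *\<^sub>R p)) / (y \<bullet> p)"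
| "cg_beta DL e e' p y = (e \<bullet> (y - (1 / 10) *\<^sub>R p)) / (y \<bullet> p)"

fun three_term_beta ::
    "three_term_coeff \<Rightarrow> 'a::real_inner \<Rightarrow> 'a \<Rightarrow> 'a \<Rightarrow> 'a \<Rightarrow> real \<times> real" where
  "three_term_beta TT_PRP e e' p y = ((y \<bullet> e) / (norm e')\<^sup>2, - (p \<bullet> e) / (norm e')\<^sup>2)"
| "three_term_beta TT_HS e e' p y = ((y \<bullet> e) / (y \<bullet> p), - (p \<bullet> e) / (y \<bullet> p))"

fun qn_factor :: "qn_coeff \<Rightarrow> real \<Rightarrow> real" where
  "qn_factor QN_one_plus \<phi> = 1 + \<phi>"
| "qn_factor QN_one_plus_two \<phi> = 1 + 2 * \<phi>"
| "qn_factor QN_one_minus_min \<phi> = 1 - min 1 \<phi>"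

fun signed :: "sign \<Rightarrow> real \<Rightarrow> real" where
  "signed Plus t = t"
| "signed Minus t = - t"

fun gamma_term :: "gamma_form \<Rightarrow> real \<Rightarrow> real \<Rightarrow> real" where
  "gamma_term Abs_beta_R \<beta> R = \<bar>\<beta> * R\<bar>"
| "gamma_term Beta_R \<beta> R = \<beta> * R"
| "gamma_term Abs_R \<beta> R = \<bar>R\<bar>"
| "gamma_term Plain_R \<beta> R = R"

text \<open>A coefficient that enters the formula of another coefficient does so with its truncated
  value. The vector \<open>h\<close> is used by the last family only.\<close>

fun raw_direction ::
    "alg_params \<Rightarrow> direction_family \<Rightarrow> 'a::real_inner \<Rightarrow> 'a \<Rightarrow> 'a \<Rightarrow> 'a \<Rightarrow> 'a \<Rightarrow> 'a \<Rightarrow> 'a" where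
  "raw_direction P (CG c) e e' p s y h = - e + truncate P (cg_beta c e e' p y) *\<^sub>R p"
| "raw_direction P (Three_Term c) e e' p s y h =
     (let (\<beta>\<^sub>1, \<beta>\<^sub>2) = three_term_beta c e e' p y
      in - e + truncate P \<beta>\<^sub>1 *\<^sub>R p + truncate P \<beta>\<^sub>2 *\<^sub>R y)"
| "raw_direction P (Quasi_Newton c) e e' p s y h =
     (let \<beta>\<^sub>3 = truncate P (- (s \<bullet> e) / (y \<bullet> s));
          \<beta>\<^sub>4 = truncate P (qn_factor c ((norm y)\<^sup>2 / (y \<bullet> s)) * \<beta>\<^sub>3 + (y \<bullet> e) / (y \<bullet> s))
      in - e + \<beta>\<^sub>3 *\<^sub>R y + \<beta>\<^sub>4 *\<^sub>R s)"
| "raw_direction P (Auxiliary c sg gf) e e' p s y h =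
     (let \<beta> = truncate P (cg_beta c e e' p y);
          R = (e \<bullet> p) / (norm e' * norm p);
          \<gamma>\<^sub>0 = 1 + signed sg (gamma_bar P * gamma_term gf \<beta> R);
          \<gamma> = max (varsigma1 P) (min (varsigma2 P) \<gamma>\<^sub>0);
          \<beta>\<^sub>5 = truncate P (- ((\<gamma> - 1) * (norm e)\<^sup>2 + \<beta> * (e \<bullet> p)) / (e \<bullet> h))
      in - e + \<beta> *\<^sub>R p + \<beta>\<^sub>5 *\<^sub>R h)"

definition angle_condition :: "real \<Rightarrow> 'a::real_inner \<Rightarrow> 'a \<Rightarrow> bool" where
  "angle_condition \<Delta> e p \<longleftrightarrow> (p \<bullet> e) / (norm p * norm e) \<le> - \<Delta>"

definition angle_safeguard :: "real \<Rightarrow> 'a::real_inner \<Rightarrow> 'a \<Rightarrow> 'a" where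
  "angle_safeguard \<Delta> e p =
     (if angle_condition \<Delta> e p then p
      else let \<sigma>\<^sub>1 = (norm e)\<^sup>2; \<sigma>\<^sub>2 = (norm p)\<^sup>2; \<sigma> = e \<bullet> p;
               w = (\<sigma>\<^sub>1 * \<sigma>\<^sub>2 - \<sigma>\<^sup>2) / (1 - \<Delta>\<^sup>2)
           in if w > 0 then p - ((\<sigma> + \<Delta> * sqrt w) / \<sigma>\<^sub>1) *\<^sub>R e else - e)"

text \<open>In \<^term>\<open>angle_safeguard\<close> the Cauchy--Schwarz inequality gives \<open>w \<ge> 0\<close>, so the last branch
  is the case \<open>w = 0\<close>.\<close>

definition direction_rule ::
    "alg_params \<Rightarrow> 'a::real_inner \<Rightarrow> 'a \<Rightarrow> 'a \<Rightarrow> 'a \<Rightarrow> 'a \<Rightarrow> 'a \<Rightarrow> bool" where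
  "direction_rule P e e' p s y\<^sub>0 p\<^sub>n \<longleftrightarrow>
     (\<exists>y h. safeguarded_y (phi_max P) (psi_max P) p s y\<^sub>0 y \<and> e \<bullet> h \<noteq> 0 \<and>
        (let d = raw_direction P (dir_family P) e e' p s y h
         in p\<^sub>n = angle_safeguard (Delta_a P) e (if d = 0 then - e else d)))"

definition mid :: "real \<Rightarrow> real \<Rightarrow> real \<Rightarrow> real" where
  "mid a b c = max (min a b) (max (min b c) (min a c))"

definition scaled :: "real \<Rightarrow> 'a::real_inner \<Rightarrow> 'a \<Rightarrow> 'a" where
  "scaled \<zeta> e p = (mid (\<zeta> * norm e) (norm p) (norm e) / norm p) *\<^sub>R p"


subsection \<open>Infinite runs\<close>

text \<open>\<open>p\<close>, \<open>psc\<close>, \<open>xb\<close> are the sequences of unscaled directions, of scaled directions and of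
  trial points.\<close>

definition generated_by_algorithm ::
    "alg_params \<Rightarrow> ('a::{real_inner,heine_borel} \<Rightarrow> 'a) \<Rightarrow> (nat \<Rightarrow> 'a) \<Rightarrow> bool" where
  "generated_by_algorithm P E x \<longleftrightarrow>
     (\<exists>p psc xb.
        p 0 = - E (x 0) \<and> psc 0 = - E (x 0) \<and>
        (\<forall>l. E (x l) \<noteq> 0 \<and>
             (\<exists>\<mu>. step_size E (rho P) (step_ver P) (x l) (psc l) \<mu> \<and>
                  xb l = x l + \<mu> *\<^sub>R psc l) \<and>
             x (Suc l) = closest_point {z. (z - xb l) \<bullet> E (xb l) \<le> 0} (x l) \<and>
             direction_rule P (E (x (Suc l))) (E (x l)) (p l)
               (xb l - x l) (E (xb l) - E (x l)) (p (Suc l)) \<and>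
             psc (Suc l) = scaled (zeta P) (E (x (Suc l))) (p (Suc l))))"

end

theory Submission
  imports Defs
begin

text \<open>The direction formulas influence the convergence only through two facts about the scaled
  direction \<open>v\<close> at a point with residual \<open>e\<close>: the angle bound \<open>v \<bullet> e \<le> - \<Delta> \<bar>v\<bar> \<bar>e\<bar>\<close> and the size
  bounds \<open>\<zeta> \<bar>e\<bar> \<le> \<bar>v\<bar> \<le> \<bar>e\<bar>\<close>. The angle safeguard and the scaling enforce both, whatever
  nonzero vector they are applied to (\<open>safeguarded_scaled_direction\<close>).

  Lipschitz continuity turns them into a lower bound on \<open>(x - xb) \<bullet> E xb\<close> of order \<open>\<bar>E x\<bar>\<^sup>2\<close>, where
  \<open>xb\<close> is the trial point. Hence \<open>x\<close> lies at distance at least \<open>c \<bar>E x\<bar>\<close> from the halfspace onto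
  which it is projected. By monotonicity the halfspace contains every solution \<open>z\<close>, so the
  obtuse-angle property of projections yields the Fejer-type estimate
  \<open>\<bar>x' - z\<bar>\<^sup>2 \<le> \<bar>x - z\<bar>\<^sup>2 - c\<^sup>2 \<bar>E x\<bar>\<^sup>2\<close> with one constant \<open>c > 0\<close> for the whole run
  (\<open>algorithm_fejer_decrease\<close>).

  Everything else follows from this estimate. It makes the residuals square summable, so every
  cluster point of the iterates is a solution, and a Fejer monotone sequence with this property
  converges. If in addition the residual dominates a fixed multiple of the distance, be it the
  distance to the solution set (local error bound) or to the limit (a nonsingular Jacobian), then
  the estimate contracts that distance by a fixed factor in each step
  (\<open>residual_decrease_geometric\<close>). A geometric sequence is \<open>o(1 / l)\<close>, which gives the stated rates,
  the rate \<open>o(l powr (- 1 / 2))\<close> with room to spare.\<close>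

section \<open>Search directions and step sizes\<close>

text \<open>If \<open>w > 0\<close>, the safeguard subtracts the multiple of \<open>e\<close> for which the new vector makes an
  angle of cosine exactly \<open>- \<Delta>\<close> with \<open>e\<close>: its inner product with \<open>e\<close> is \<open>- \<Delta> sqrt w\<close> and its
  norm is \<open>sqrt w / \<bar>e\<bar>\<close>. The vector \<open>- e\<close> of the remaining case has cosine \<open>- 1\<close>.\<close>

lemma angle_safeguard_sound:
  fixes e d :: "'a::real_inner"
  assumes "e \<noteq> 0" "d \<noteq> 0" "0 < \<Delta>" "\<Delta> < 1"
  shows "angle_safeguard \<Delta> e d \<noteq> 0 \<and>
         angle_safeguard \<Delta> e d \<bullet> e \<le> - \<Delta> * norm (angle_safeguard \<Delta> e d) * norm e"
proof (cases "angle_condition \<Delta> e d")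
  case True
  then show ?thesis
    using assms by (simp add: angle_safeguard_def angle_condition_def pos_divide_le_eq mult.assoc)
next
  case False
  define S where "S = (norm e)\<^sup>2"
  define \<sigma> where "\<sigma> = e \<bullet> d"
  define w where "w = (S * (norm d)\<^sup>2 - \<sigma>\<^sup>2) / (1 - \<Delta>\<^sup>2)"
  define t where "t = (\<sigma> + \<Delta> * sqrt w) / S"
  have S: "S > 0" using assms by (simp add: S_def)
  have D: "1 - \<Delta>\<^sup>2 > 0" using assms by (simp add: power_less_one_iff)
  show ?thesis
  proof (cases "w > 0")
    case True
    have p: "angle_safeguard \<Delta> e d = d - t *\<^sub>R e"
      using False True
      by (simp add: angle_safeguard_def t_def w_def S_def \<sigma>_def Let_def)
    have tS: "t * S = \<sigma> + \<Delta> * sqrt w" using S by (simp add: t_def)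
    have ee: "e \<bullet> e = S" by (simp add: S_def power2_norm_eq_inner)
    have pe: "(d - t *\<^sub>R e) \<bullet> e = - \<Delta> * sqrt w"
      using tS by (simp add: inner_diff_left ee \<sigma>_def inner_commute[of d e])
    have "S * (norm (d - t *\<^sub>R e))\<^sup>2 = S * (norm d)\<^sup>2 - 2 * (t * S) * \<sigma> + (t * S)\<^sup>2"
      unfolding power2_norm_eq_inner
      by (simp add: inner_diff_left inner_diff_right ee inner_commute[of d e]
          flip: \<sigma>_def) (simp add: power2_eq_square algebra_simps)
    also have "\<dots> = S * (norm d)\<^sup>2 - \<sigma>\<^sup>2 + \<Delta>\<^sup>2 * (sqrt w)\<^sup>2"
      unfolding tS by (simp add: power2_eq_square algebra_simps)
    also have "S * (norm d)\<^sup>2 - \<sigma>\<^sup>2 = w * (1 - \<Delta>\<^sup>2)" using D by (simp add: w_def)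
    also have "w * (1 - \<Delta>\<^sup>2) + \<Delta>\<^sup>2 * (sqrt w)\<^sup>2 = w"
      using True by (simp add: algebra_simps)
    finally have "(norm (d - t *\<^sub>R e) * norm e)\<^sup>2 = w"
      by (simp add: S_def power_mult_distrib mult.commute)
    then have n: "norm (d - t *\<^sub>R e) * norm e = sqrt w"
      by (metis norm_ge_zero mult_nonneg_nonneg real_sqrt_unique)
    have "d - t *\<^sub>R e \<noteq> 0" using n True by auto
    then show ?thesis unfolding p mult.assoc n pe by simp
  next
    case w: False
    have p: "angle_safeguard \<Delta> e d = - e"
      using False w by (simp add: angle_safeguard_def w_def S_def \<sigma>_def Let_def)
    have "\<Delta> * (norm e * norm e) \<le> 1 * (norm e * norm e)"
      using assms by (intro mult_right_mono) auto
    then show ?thesis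
      using assms unfolding p by (simp add: mult.assoc power2_norm_eq_inner flip: power2_eq_square)
  qed
qed

definition good_direction :: "real \<Rightarrow> real \<Rightarrow> 'a::real_inner \<Rightarrow> 'a \<Rightarrow> bool" where
  "good_direction \<Delta> \<zeta> e v \<longleftrightarrow>
     v \<bullet> e \<le> - \<Delta> * norm v * norm e \<and> \<zeta> * norm e \<le> norm v \<and> norm v \<le> norm e"

lemma good_direction_uminus:
  assumes "\<Delta> < 1" "\<zeta> < 1"
  shows "good_direction \<Delta> \<zeta> e (- e)"
proof -
  have "\<Delta> * (norm e * norm e) \<le> 1 * (norm e * norm e)"
    using assms by (intro mult_right_mono) auto
  moreover have "\<zeta> * norm e \<le> 1 * norm e"
    using assms by (intro mult_right_mono) auto
  ultimately show ?thesis
    unfolding good_direction_def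
    by (simp add: mult.assoc power2_norm_eq_inner flip: power2_eq_square)
qed

lemma safeguarded_scaled_direction:
  fixes e d :: "'a::real_inner"
  assumes "e \<noteq> 0" "d \<noteq> 0" "0 < \<Delta>" "\<Delta> < 1" "0 < \<zeta>" "\<zeta> < 1"
  shows "good_direction \<Delta> \<zeta> e (scaled \<zeta> e (angle_safeguard \<Delta> e d))"
proof -
  define p where "p = angle_safeguard \<Delta> e d"
  define m where "m = mid (\<zeta> * norm e) (norm p) (norm e)"
  have p: "p \<noteq> 0" "p \<bullet> e \<le> - \<Delta> * norm p * norm e"
    using angle_safeguard_sound[OF assms(1-4)] by (simp_all add: p_def)
  have "\<zeta> * norm e \<le> 1 * norm e" using assms by (intro mult_right_mono) auto
  then have m: "\<zeta> * norm e \<le> m" "m \<le> norm e"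
    unfolding m_def mid_def by (auto simp: max_def min_def)
  moreover have "0 < \<zeta> * norm e" using assms by simp
  ultimately have m0: "0 < m" by linarith
  have n: "norm ((m / norm p) *\<^sub>R p) = m" using p(1) m0 by simp
  have "(m / norm p) *\<^sub>R p \<bullet> e = (m / norm p) * (p \<bullet> e)" by simp
  also have "\<dots> \<le> (m / norm p) * (- \<Delta> * norm p * norm e)"
    using m0 p by (intro mult_left_mono) auto
  also have "\<dots> = - \<Delta> * m * norm e" using p(1) by simp
  finally show ?thesis
    using n m unfolding good_direction_def scaled_def p_def[symmetric] m_def[symmetric] by simp
qed

lemma generated_by_algorithm_good_directions:
  assumes "valid_params L P" "generated_by_algorithm P E x"
  obtains v \<mu> where
    "\<And>l. E (x l) \<noteq> 0"
    "\<And>l. good_direction (Delta_a P) (zeta P) (E (x l)) (v l)"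
    "\<And>l. step_size E (rho P) (step_ver P) (x l) (v l) (\<mu> l)"
    "\<And>l. x (Suc l) = closest_point
        {z. (z - (x l + \<mu> l *\<^sub>R v l)) \<bullet> E (x l + \<mu> l *\<^sub>R v l) \<le> 0} (x l)"
proof -
  have par: "0 < Delta_a P" "Delta_a P < 1" "0 < zeta P" "zeta P < 1"
    using assms(1) by (auto simp: valid_params_def)
  obtain p psc xb where run:
    "psc 0 = - E (x 0)"
    "\<And>l. E (x l) \<noteq> 0"
    "\<And>l. \<exists>\<mu>. step_size E (rho P) (step_ver P) (x l) (psc l) \<mu> \<and> xb l = x l + \<mu> *\<^sub>R psc l"
    "\<And>l. x (Suc l) = closest_point {z. (z - xb l) \<bullet> E (xb l) \<le> 0} (x l)"
    "\<And>l. direction_rule P (E (x (Suc l))) (E (x l)) (p l)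
               (xb l - x l) (E (xb l) - E (x l)) (p (Suc l))"
    "\<And>l. psc (Suc l) = scaled (zeta P) (E (x (Suc l))) (p (Suc l))"
    using assms(2) unfolding generated_by_algorithm_def by blast
  obtain \<mu> where \<mu>: "\<And>l. step_size E (rho P) (step_ver P) (x l) (psc l) (\<mu> l)"
    "\<And>l. xb l = x l + \<mu> l *\<^sub>R psc l"
    using run(3) by metis
  have "good_direction (Delta_a P) (zeta P) (E (x l)) (psc l)" for l
  proof (cases l)
    case 0
    then show ?thesis using good_direction_uminus par run(1) by simp
  next
    case (Suc k)
    obtain d where "p (Suc k) = angle_safeguard (Delta_a P) (E (x (Suc k)))
        (if d = 0 then - E (x (Suc k)) else d)"
      using run(5)[of k] unfolding direction_rule_def Let_def by blast
    then show ?thesis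
      using safeguarded_scaled_direction[OF run(2) _ par] run(2)[of "Suc k"]
      by (simp add: Suc run(6))
  qed
  then show ?thesis using that[of psc \<mu>] run(2,4) \<mu> by simp
qed

lemma trial_step_ge: "\<mu>\<^sub>m \<le> \<mu>\<^sub>0 \<Longrightarrow> \<mu>\<^sub>m \<le> trial_step \<mu>\<^sub>0 \<gamma> \<mu>\<^sub>m k"
  by (cases k) auto

lemma trial_step_le:
  assumes "\<mu>\<^sub>m \<le> \<mu>\<^sub>0" "0 < \<mu>\<^sub>m" "1 < \<gamma>"
  shows "trial_step \<mu>\<^sub>0 \<gamma> \<mu>\<^sub>m k \<le> \<mu>\<^sub>0"
proof (induction k)
  case (Suc k)
  have pos: "0 < trial_step \<mu>\<^sub>0 \<gamma> \<mu>\<^sub>m k" using trial_step_ge[of \<mu>\<^sub>m \<mu>\<^sub>0 \<gamma> k] assms by linarith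
  then have "trial_step \<mu>\<^sub>0 \<gamma> \<mu>\<^sub>m k / \<gamma> \<le> trial_step \<mu>\<^sub>0 \<gamma> \<mu>\<^sub>m k"
    using assms by (simp add: field_simps)
  then show ?case using Suc assms by simp
qed simp

text \<open>A step of length at most \<open>\<Delta> / (L + \<rho>)\<close> needs no test: along the step the operator changes
  by at most \<open>L \<alpha> \<bar>v\<bar>\<close>, which uses up only part of the descent \<open>\<Delta> \<bar>v\<bar>\<close> that the angle bound
  provides.\<close>

lemma short_step_acceptable:
  assumes "L-lipschitz_on UNIV E" "0 < L" "0 < \<rho>" "0 < \<alpha>" "\<alpha> \<le> \<Delta> / (L + \<rho>)"
    and "good_direction \<Delta> \<zeta> (E x) v"
  shows "acceptable_step E \<rho> x v \<alpha>"
proof -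
  have \<alpha>: "\<alpha> * L + \<alpha> * \<rho> \<le> \<Delta>"
    using assms by (simp add: pos_le_divide_eq algebra_simps)
  moreover have "0 \<le> \<alpha> * L" "0 \<le> \<alpha> * \<rho>" using assms by simp_all
  ultimately have \<Delta>: "0 \<le> \<Delta>" by linarith
  have v: "v \<bullet> E x \<le> - \<Delta> * norm v * norm (E x)" "norm v \<le> norm (E x)"
    using assms(6) by (auto simp: good_direction_def)
  have "norm (E (x + \<alpha> *\<^sub>R v) - E x) \<le> L * (\<alpha> * norm v)"
    using lipschitz_onD[OF assms(1), of "x + \<alpha> *\<^sub>R v" x] assms(4) by (simp add: dist_norm)
  then have "norm v * norm (E (x + \<alpha> *\<^sub>R v) - E x) \<le> norm v * (L * (\<alpha> * norm v))"
    by (intro mult_left_mono) auto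
  then have 1: "v \<bullet> (E (x + \<alpha> *\<^sub>R v) - E x) \<le> \<alpha> * L * (norm v)\<^sup>2"
    using norm_cauchy_schwarz[of v "E (x + \<alpha> *\<^sub>R v) - E x"]
    by (simp add: power2_eq_square algebra_simps)
  have "\<Delta> * norm v * norm v \<le> \<Delta> * norm v * norm (E x)"
    using v(2) \<Delta> by (intro mult_left_mono) auto
  then have 2: "v \<bullet> E x \<le> - \<Delta> * (norm v)\<^sup>2"
    using v(1) by (simp add: power2_eq_square mult.assoc)
  have "(\<alpha> * L + \<alpha> * \<rho>) * (norm v)\<^sup>2 \<le> \<Delta> * (norm v)\<^sup>2"
    using \<alpha> by (intro mult_right_mono) auto
  then show ?thesis
    using 1 2 by (simp add: acceptable_step_def inner_diff_right algebra_simps)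
qed

fun step_lower_bound :: "step_version \<Rightarrow> real" where
  "step_lower_bound (Line_Search \<mu>\<^sub>0 \<gamma> \<mu>\<^sub>m) = \<mu>\<^sub>m"
| "step_lower_bound (Fixed_Step \<alpha>) = \<alpha>"

lemma step_lower_bound_pos: "valid_step_version L \<Delta> \<rho> V \<Longrightarrow> 0 < step_lower_bound V"
  by (cases V) auto

lemma step_size_bounds:
  assumes "L-lipschitz_on UNIV E" "0 < L" "0 < \<rho>"
    and "good_direction \<Delta> \<zeta> (E x) v"
    and "valid_step_version L \<Delta> \<rho> V" "step_size E \<rho> V x v \<mu>"
  shows "step_lower_bound V \<le> \<mu>" "\<mu> \<le> 1" "acceptable_step E \<rho> x v \<mu>"
proof -
  have "step_lower_bound V \<le> \<mu> \<and> \<mu> \<le> 1 \<and> acceptable_step E \<rho> x v \<mu>"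
  proof (cases V)
    case (Line_Search \<mu>\<^sub>0 \<gamma> \<mu>\<^sub>m)
    then show ?thesis
      using assms(5,6) trial_step_ge[of \<mu>\<^sub>m \<mu>\<^sub>0 \<gamma>] trial_step_le[of \<mu>\<^sub>m \<mu>\<^sub>0 \<gamma>]
      by (auto intro: order_trans)
  next
    case (Fixed_Step \<alpha>)
    then show ?thesis using short_step_acceptable[OF assms(1-3) _ _ assms(4)] assms(5,6) by auto
  qed
  then show "step_lower_bound V \<le> \<mu>" "\<mu> \<le> 1" "acceptable_step E \<rho> x v \<mu>" by auto
qed

section \<open>Fejer monotonicity of the projection step\<close>

text \<open>The inner product on the right is the amount by which \<open>a\<close> violates the inequality that
  defines the halfspace, so it is at most \<open>\<bar>g\<bar>\<close> times the distance of \<open>a\<close> from the halfspace.\<close>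

lemma halfspace_projection_step:
  fixes a b g z :: "'a::{real_inner,heine_borel}"
  assumes a': "a' = closest_point {u. (u - b) \<bullet> g \<le> 0} a" and z: "(z - b) \<bullet> g \<le> 0"
  shows "(norm (a' - z))\<^sup>2 \<le> (norm (a - z))\<^sup>2 - (norm (a - a'))\<^sup>2"
    and "(a - b) \<bullet> g \<le> norm (a - a') * norm g"
proof -
  define H where "H = {u. (u - b) \<bullet> g \<le> 0}"
  have H: "H = {u. g \<bullet> u \<le> g \<bullet> b}"
    by (auto simp: H_def inner_diff_left inner_diff_right inner_commute)
  have cl: "closed H" unfolding H by (rule closed_halfspace_le)
  have cv: "convex H" unfolding H by (rule convex_halfspace_le)
  have zH: "z \<in> H" using z by (simp add: H_def)
  have "(a - a') \<bullet> (z - a') \<le> 0"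
    unfolding a' H_def[symmetric] by (rule closest_point_dot[OF cv cl zH])
  moreover have "(norm (a - z))\<^sup>2 = (norm (a' - z))\<^sup>2 + (norm (a - a'))\<^sup>2 - 2 * ((a - a') \<bullet> (z - a'))"
    unfolding power2_norm_eq_inner by (simp add: inner_diff_left inner_diff_right inner_commute)
  ultimately show "(norm (a' - z))\<^sup>2 \<le> (norm (a - z))\<^sup>2 - (norm (a - a'))\<^sup>2" by linarith
  have "a' \<in> H" unfolding a' H_def[symmetric] by (rule closest_point_in_set[OF cl]) (use zH in auto)
  then have "(a' - b) \<bullet> g \<le> 0" by (simp add: H_def)
  then have "(a - b) \<bullet> g \<le> (a - a') \<bullet> g" by (simp add: inner_diff_left)
  then show "(a - b) \<bullet> g \<le> norm (a - a') * norm g"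
    using norm_cauchy_schwarz order_trans by blast
qed

text \<open>The step length \<open>\<mu> \<bar>v\<bar>\<close> is at least \<open>m \<zeta> \<bar>E a\<bar>\<close>, so \<open>a\<close> violates the
  inequality of the halfspace by at least \<open>\<rho> (m \<zeta> \<bar>E a\<bar>)\<^sup>2\<close>; its normal vector is bounded by
  \<open>(1 + L) \<bar>E a\<bar>\<close> since the step is no longer than \<open>\<bar>E a\<bar>\<close>. The quotient of the two bounds is
  the distance that the projection covers at least.\<close>

lemma projection_step_fejer_decrease:
  fixes E :: "'a::{real_inner,heine_borel} \<Rightarrow> 'a"
  assumes mono: "monotone_operator E" and L: "0 < L" "L-lipschitz_on UNIV E"
    and pos: "0 < \<rho>" "0 < m" "0 < \<zeta>"
    and \<mu>: "m \<le> \<mu>" "\<mu> \<le> 1" "acceptable_step E \<rho> a v \<mu>"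
    and v: "\<zeta> * norm (E a) \<le> norm v" "norm v \<le> norm (E a)"
    and a: "E a \<noteq> 0"
    and a': "a' = closest_point {u. (u - (a + \<mu> *\<^sub>R v)) \<bullet> E (a + \<mu> *\<^sub>R v) \<le> 0} a"
    and z: "E z = 0"
  shows "(norm (a' - z))\<^sup>2 \<le> (norm (a - z))\<^sup>2 - (\<rho> * (m * \<zeta>)\<^sup>2 / (1 + L))\<^sup>2 * (norm (E a))\<^sup>2"
proof -
  define b where "b = a + \<mu> *\<^sub>R v"
  let ?c = "\<rho> * (m * \<zeta>)\<^sup>2 / (1 + L)"
  have N: "0 < norm (E a)" using a by simp
  have \<mu>0: "0 < \<mu>" using \<mu> pos by linarith
  have "0 \<le> (E b - E z) \<bullet> (b - z)" using mono by (simp add: monotone_operator_def)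
  then have zH: "(z - b) \<bullet> E b \<le> 0" by (simp add: z inner_diff_left inner_diff_right inner_commute)
  have "m * (\<zeta> * norm (E a)) \<le> \<mu> * norm v"
    using v \<mu> \<mu>0 pos by (intro mult_mono) auto
  then have "(m * \<zeta> * norm (E a))\<^sup>2 \<le> (\<mu> * norm v)\<^sup>2"
    using pos by (intro power_mono) (auto simp: mult.assoc)
  then have "\<rho> * ((m * \<zeta>)\<^sup>2 * (norm (E a))\<^sup>2) \<le> \<rho> * (\<mu>\<^sup>2 * (norm v)\<^sup>2)"
    using pos by (intro mult_left_mono) (auto simp: power_mult_distrib)
  also have "\<dots> \<le> (a - b) \<bullet> E b"
  proof -
    have "\<mu> * (v \<bullet> E b) \<le> \<mu> * (- \<rho> * \<mu> * (norm v)\<^sup>2)"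
      using \<mu>(3) \<mu>0 by (intro mult_left_mono) (auto simp: acceptable_step_def b_def)
    then show ?thesis by (simp add: b_def power2_eq_square algebra_simps)
  qed
  also have "\<dots> \<le> norm (a - a') * norm (E b)"
    using halfspace_projection_step(2)[OF a'[folded b_def] zH] .
  also have "\<dots> \<le> norm (a - a') * ((1 + L) * norm (E a))"
  proof (intro mult_left_mono)
    have "norm (E b - E a) \<le> L * (\<mu> * norm v)"
      using lipschitz_onD[OF L(2), of b a] \<mu>0 by (simp add: b_def dist_norm)
    also have "\<dots> \<le> L * (1 * norm (E a))"
      using \<mu> v L \<mu>0 by (intro mult_left_mono mult_mono) auto
    finally show "norm (E b) \<le> (1 + L) * norm (E a)"
      using norm_triangle_sub[of "E b" "E a"] by (simp add: algebra_simps)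
  qed simp
  finally have "(\<rho> * (m * \<zeta>)\<^sup>2 * norm (E a)) * norm (E a) \<le> (norm (a - a') * (1 + L)) * norm (E a)"
    by (simp add: power2_eq_square algebra_simps)
  then have "\<rho> * (m * \<zeta>)\<^sup>2 * norm (E a) \<le> norm (a - a') * (1 + L)"
    using N by (rule mult_right_le_imp_le)
  then have "?c * norm (E a) \<le> norm (a - a')"
    using L by (simp add: pos_divide_le_eq)
  then have "(?c * norm (E a))\<^sup>2 \<le> (norm (a - a'))\<^sup>2"
    using L pos by (intro power_mono) auto
  then show ?thesis
    using halfspace_projection_step(1)[OF a'[folded b_def] zH] by (simp only: power_mult_distrib[of ?c])
qed

lemma algorithm_fejer_decrease:
  fixes E :: "'a::{real_inner,heine_borel} \<Rightarrow> 'a"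
  assumes "monotone_operator E" "0 < L" "L-lipschitz_on UNIV E"
    and P: "valid_params L P" and run: "generated_by_algorithm P E x"
  obtains \<kappa> where "0 < \<kappa>"
    "\<And>l z. z \<in> solution_set E \<Longrightarrow>
       (norm (x (Suc l) - z))\<^sup>2 \<le> (norm (x l - z))\<^sup>2 - \<kappa> * (norm (E (x l)))\<^sup>2"
proof -
  define m where "m = step_lower_bound (step_ver P)"
  have par: "0 < rho P" "0 < zeta P"
    "valid_step_version L (Delta_a P) (rho P) (step_ver P)"
    using P by (auto simp: valid_params_def)
  have m: "0 < m" using step_lower_bound_pos[OF par(3)] by (simp add: m_def)
  obtain v \<mu> where v:
    "\<And>l. E (x l) \<noteq> 0"
    "\<And>l. good_direction (Delta_a P) (zeta P) (E (x l)) (v l)"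
    "\<And>l. step_size E (rho P) (step_ver P) (x l) (v l) (\<mu> l)"
    "\<And>l. x (Suc l) = closest_point
        {z. (z - (x l + \<mu> l *\<^sub>R v l)) \<bullet> E (x l + \<mu> l *\<^sub>R v l) \<le> 0} (x l)"
    using generated_by_algorithm_good_directions[OF P run] by blast
  let ?\<kappa> = "(rho P * (m * zeta P)\<^sup>2 / (1 + L))\<^sup>2"
  have "0 < ?\<kappa>" using par m assms(2) by simp
  moreover have "(norm (x (Suc l) - z))\<^sup>2 \<le> (norm (x l - z))\<^sup>2 - ?\<kappa> * (norm (E (x l)))\<^sup>2"
    if "z \<in> solution_set E" for l z
  proof (rule projection_step_fejer_decrease[OF assms(1-3) par(1) m par(2) _ _ _ _ _ v(1) v(4)])
    note step = step_size_bounds[OF assms(3,2) par(1) v(2) par(3) v(3)]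
    show "m \<le> \<mu> l" "\<mu> l \<le> 1" "acceptable_step E (rho P) (x l) (v l) (\<mu> l)"
      using step by (simp_all add: m_def)
    show "zeta P * norm (E (x l)) \<le> norm (v l)" "norm (v l) \<le> norm (E (x l))"
      using v(2) by (auto simp: good_direction_def)
    show "E z = 0" using that by (simp add: solution_set_def)
  qed
  ultimately show ?thesis using that by blast
qed

section \<open>Convergence and rates from the Fejer estimate\<close>

lemma summable_of_decrease:
  fixes a e :: "nat \<Rightarrow> real"
  assumes "\<And>l. 0 \<le> a l" "\<And>l. 0 \<le> e l" "\<And>l. a (Suc l) \<le> a l - e l"
  shows "summable e"
proof (rule summableI_nonneg_bounded)
  show "(\<Sum>i<n. e i) \<le> a 0" for n
  proof -
    have "(\<Sum>i<n. e i) \<le> a 0 - a n"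
    proof (induction n)
      case (Suc n)
      then show ?case using assms(3)[of n] by simp
    qed simp
    then show ?thesis using assms(1)[of n] by linarith
  qed
qed (use assms in auto)

text \<open>The sequence is bounded and so has a cluster point, and the distance to a cluster point in \<open>S\<close> is
  nonincreasing and small infinitely often.\<close>

lemma fejer_monotone_converges:
  fixes x :: "nat \<Rightarrow> 'a::heine_borel"
  assumes "S \<noteq> {}" and fejer: "\<And>z l. z \<in> S \<Longrightarrow> dist (x (Suc l)) z \<le> dist (x l) z"
    and cluster: "\<And>r z. strict_mono r \<Longrightarrow> (x \<circ> r) \<longlonglongrightarrow> z \<Longrightarrow> z \<in> S"
  shows "\<exists>z\<in>S. x \<longlonglongrightarrow> z"
proof -
  have anti: "dist (x l) z \<le> dist (x k) z" if "z \<in> S" "k \<le> l" for z k l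
    using that(2) by (induction rule: dec_induct) (use fejer[OF that(1)] order_trans in auto)
  obtain s where s: "s \<in> S" using assms(1) by blast
  have "range x \<subseteq> cball s (dist (x 0) s)" using anti[OF s, of 0] by (auto simp: dist_commute)
  then have "bounded (range x)" using bounded_subset bounded_cball by blast
  then obtain z r where r: "strict_mono r" "(x \<circ> r) \<longlonglongrightarrow> z"
    using bounded_imp_convergent_subsequence by blast
  have z: "z \<in> S" using cluster[OF r] .
  have "x \<longlonglongrightarrow> z"
  proof (rule metric_LIMSEQ_I)
    fix \<epsilon> :: real assume "0 < \<epsilon>"
    then obtain k where "dist (x (r k)) z < \<epsilon>" using metric_LIMSEQ_D[OF r(2)] by fastforce
    then show "\<exists>no. \<forall>n\<ge>no. dist (x n) z < \<epsilon>" using anti[OF z] by (meson le_less_trans)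
  qed
  then show ?thesis using z by blast
qed

text \<open>In the squared distances the contraction factor is \<open>1 - \<kappa> \<theta>\<^sup>2\<close>; the maximum with \<open>1 / 2\<close> keeps
  the rate \<open>q\<close> positive.\<close>

lemma residual_decrease_geometric:
  fixes a e :: "nat \<Rightarrow> real"
  assumes a: "\<And>l. 0 \<le> a l" and "0 < \<kappa>" "0 < \<theta>"
    and dec: "\<And>l. (a (Suc l))\<^sup>2 \<le> (a l)\<^sup>2 - \<kappa> * (e l)\<^sup>2"
    and bound: "\<forall>\<^sub>F l in sequentially. \<theta> * a l \<le> e l"
  obtains l\<^sub>0 q where "0 < q" "q < 1" "\<And>l. l\<^sub>0 \<le> l \<Longrightarrow> a l \<le> a l\<^sub>0 * q ^ (l - l\<^sub>0)"
proof -
  define Q where "Q = max (1 / 2) (1 - \<kappa> * \<theta>\<^sup>2)"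
  define q where "q = sqrt Q"
  have Q: "0 < Q" "Q < 1" using assms(2,3) by (auto simp: Q_def)
  then have q: "0 < q" "q < 1" "q\<^sup>2 = Q" by (auto simp: q_def)
  obtain l\<^sub>0 where l0: "\<And>l. l\<^sub>0 \<le> l \<Longrightarrow> \<theta> * a l \<le> e l"
    using bound by (auto simp: eventually_sequentially)
  have step: "a (Suc l) \<le> q * a l" if "l\<^sub>0 \<le> l" for l
  proof (rule power2_le_imp_le)
    have "(\<theta> * a l)\<^sup>2 \<le> (e l)\<^sup>2" using l0[OF that] a assms(3) by (intro power_mono) auto
    then have "\<kappa> * (\<theta> * a l)\<^sup>2 \<le> \<kappa> * (e l)\<^sup>2" using assms(2) by simp
    then have "(a (Suc l))\<^sup>2 \<le> (1 - \<kappa> * \<theta>\<^sup>2) * (a l)\<^sup>2"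
      using dec[of l] by (simp add: power_mult_distrib algebra_simps)
    also have "\<dots> \<le> Q * (a l)\<^sup>2" by (intro mult_right_mono) (auto simp: Q_def)
    finally show "(a (Suc l))\<^sup>2 \<le> (q * a l)\<^sup>2" by (simp add: power_mult_distrib q(3))
  qed (use a q in simp)
  have "a l \<le> a l\<^sub>0 * q ^ (l - l\<^sub>0)" if "l\<^sub>0 \<le> l" for l
    using that
  proof (induction rule: dec_induct)
    case (step l)
    have "a (Suc l) \<le> q * a l" by (rule \<open>\<And>l. l\<^sub>0 \<le> l \<Longrightarrow> a (Suc l) \<le> q * a l\<close>) (rule step.hyps)
    also have "\<dots> \<le> q * (a l\<^sub>0 * q ^ (l - l\<^sub>0))" using step.IH q by (intro mult_left_mono) auto
    also have "\<dots> = a l\<^sub>0 * q ^ (Suc l - l\<^sub>0)" using step.hyps by (simp add: Suc_diff_le)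
    finally show ?case .
  qed simp
  then show ?thesis using that q by blast
qed

lemma geometric_bound_smallo_inverse:
  fixes a :: "nat \<Rightarrow> real"
  assumes "0 < q" "q < 1" and bound: "\<And>l. l\<^sub>0 \<le> l \<Longrightarrow> \<bar>a l\<bar> \<le> M * q ^ (l - l\<^sub>0)"
  shows "a \<in> o(\<lambda>l. 1 / real l)"
proof (rule landau_o.big_small_trans)
  have "\<forall>\<^sub>F l in sequentially. norm (a l) \<le> (M / q ^ l\<^sub>0) * norm (q ^ l)"
    using eventually_ge_at_top[of l\<^sub>0]
    by eventually_elim (use bound assms in \<open>simp add: power_diff\<close>)
  then show "a \<in> O(\<lambda>l. q ^ l)" by (rule bigoI)
  show "(\<lambda>l. q ^ l) \<in> o(\<lambda>l. 1 / real l)"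
  proof (rule smalloI_tendsto)
    have "(\<lambda>l. of_nat l * q ^ l) \<longlonglongrightarrow> 0" using assms by (intro powser_times_n_limit_0) auto
    then show "(\<lambda>l. q ^ l / (1 / real l)) \<longlonglongrightarrow> 0" by (simp add: mult.commute)
    show "\<forall>\<^sub>F l in sequentially. 1 / real l \<noteq> 0"
      using eventually_gt_at_top[of 0] by eventually_elim simp
  qed
qed

lemma inverse_nat_bigo_powr_minus_half:
  "(\<lambda>l. 1 / real l) \<in> O(\<lambda>l. real l powr (- 1 / 2))"
proof (rule bigoI[where c = 1])
  show "\<forall>\<^sub>F l in sequentially. norm (1 / real l) \<le> 1 * norm (real l powr (- 1 / 2))"
    using eventually_gt_at_top[of 0]
  proof eventually_elim
    case (elim l)
    then have "real l powr (- 1) \<le> real l powr (- 1 / 2)" by (intro powr_mono) auto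
    then show ?case using elim by (simp add: powr_minus_divide)
  qed
qed

text \<open>The distance to a closed set is attained at some \<open>z\<close>, and the next iterate is at least as
  close to the set as to \<open>z\<close>.\<close>

lemma infdist_fejer_decrease:
  fixes a a' :: "'a::{real_normed_vector,heine_borel}"
  assumes "closed S" "S \<noteq> {}" "\<And>z. z \<in> S \<Longrightarrow> (norm (a' - z))\<^sup>2 \<le> (norm (a - z))\<^sup>2 - r"
  shows "(infdist a' S)\<^sup>2 \<le> (infdist a S)\<^sup>2 - r"
proof -
  obtain z where z: "z \<in> S" "infdist a S = dist a z"
    using infdist_attains_inf[OF assms(1,2)] by blast
  have "(infdist a' S)\<^sup>2 \<le> (norm (a' - z))\<^sup>2"
    using infdist_le[OF z(1), of a'] by (intro power_mono) (auto simp: dist_norm infdist_nonneg)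
  then show ?thesis using assms(3)[OF z(1)] z(2) by (simp add: dist_norm)
qed

section \<open>The residual near a solution with nonsingular Jacobian\<close>

text \<open>A nonzero kernel vector of \<open>A\<close> is an eigenvector of the Gram matrix for the eigenvalue \<open>0\<close>,
  which makes \<open>0\<close> a singular value.\<close>

lemma sigma_min_pos_imp_inj:
  assumes "0 < sigma_min A"
  shows "inj ((*v) A)"
proof -
  have "v = 0" if "A *v v = 0" for v
  proof (rule ccontr)
    assume "v \<noteq> 0"
    moreover have "(transpose A ** A) *v v = 0 *\<^sub>R v"
      using that by (simp flip: matrix_vector_mul_assoc)
    ultimately have "sqrt 0 \<in> singular_values A" unfolding singular_values_def by blast
    then have "sigma_min A \<le> sqrt 0"
      unfolding sigma_min_def using finite_singular_values by (rule Min_le[rotated])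
    then show False using assms by simp
  qed
  then show ?thesis
    by (metis linear_injective_0 matrix_vector_mul_linear)
qed

text \<open>An injective linear map satisfies \<open>B \<bar>h\<bar> \<le> \<bar>J h\<bar>\<close> for some \<open>B > 0\<close>, and close to \<open>z\<close> the
  linearization error is at most half of that.\<close>

lemma nonsingular_jacobian_error_bound:
  fixes E :: "real^'n \<Rightarrow> real^'n"
  assumes "E differentiable (at z)" "0 < sigma_min (jacobian E (at z))" "E z = 0"
  obtains \<theta> where "0 < \<theta>" "\<forall>\<^sub>F y in nhds z. \<theta> * norm (y - z) \<le> norm (E y)"
proof -
  let ?J = "(*v) (jacobian E (at z))"
  have D: "(E has_derivative ?J) (at z)" using assms(1) jacobian_works by blast
  obtain B where B: "0 < B" "\<And>h. B * norm h \<le> norm (?J h)"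
    using linear_inj_bounded_below_pos[OF matrix_vector_mul_linear sigma_min_pos_imp_inj[OF assms(2)]]
    by blast
  obtain d where d: "0 < d"
    "\<And>y. norm (y - z) < d \<Longrightarrow> norm (E y - E z - ?J (y - z)) \<le> (B / 2) * norm (y - z)"
    using D half_gt_zero[OF B(1)] unfolding has_derivative_at_alt by meson
  have "(B / 2) * norm (y - z) \<le> norm (E y)" if "dist y z < d" for y
  proof -
    have "norm (?J (y - z)) \<le> norm (E y) + norm (E y - ?J (y - z))"
      by (metis norm_minus_commute norm_triangle_sub)
    then show ?thesis
      using d(2)[of y] B(2)[of "y - z"] that assms(3) by (simp add: dist_norm)
  qed
  then have "\<forall>\<^sub>F y in nhds z. (B / 2) * norm (y - z) \<le> norm (E y)"
    using d(1) by (auto simp: eventually_nhds_metric)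
  then show ?thesis using that[of "B / 2"] B(1) by simp
qed

section \<open>Rates of convergence of the algorithm\<close>

theorem theorem4:
  fixes E :: "real^'n \<Rightarrow> real^'n" and L :: real and P :: alg_params
    and x :: "nat \<Rightarrow> real^'n"
  assumes "monotone_operator E"
    and "L > 0" and "L-lipschitz_on UNIV E"
    and "solution_set E \<noteq> {}"
    and "valid_params L P"
    and "generated_by_algorithm P E x"
  shows "(local_error_bound E \<longrightarrow>
            (\<lambda>l. infdist (x l) (solution_set E)) \<in> o(\<lambda>l. real l powr (- 1 / 2))) \<and>
         (\<exists>xstar \<in> solution_set E. x \<longlonglongrightarrow> xstar \<and>
            (continuously_differentiable_near E xstar \<and> sigma_min (jacobian E (at xstar)) > 0 \<longrightarrow>
               (\<exists>l\<^sub>0 q M. 0 < q \<and> q < 1 \<and> M > 0 \<and>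
                  (\<forall>l\<ge>l\<^sub>0. norm (x l - xstar) \<le> M * q ^ (l - l\<^sub>0) \<and>
                           norm (E (x l)) \<le> L * M * q ^ (l - l\<^sub>0))) \<and>
               (\<lambda>l. norm (E (x l))) \<in> o(\<lambda>l. 1 / real l)))"
proof -
  let ?S = "solution_set E"
  obtain \<kappa> where \<kappa>: "0 < \<kappa>" and fejer: "\<And>l z. z \<in> ?S \<Longrightarrow>
      (norm (x (Suc l) - z))\<^sup>2 \<le> (norm (x l - z))\<^sup>2 - \<kappa> * (norm (E (x l)))\<^sup>2"
    using algorithm_fejer_decrease[OF assms(1-3,5,6)] by blast
  have cont: "continuous_on UNIV E"
    using assms(3) by (rule lipschitz_on_continuous_on)
  have closed: "closed ?S"
    using continuous_closed_preimage_constant[OF cont, of 0] by (simp add: solution_set_def)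

  obtain s where s: "s \<in> ?S" using assms(4) by blast
  have "summable (\<lambda>l. \<kappa> * (norm (E (x l)))\<^sup>2)"
    by (rule summable_of_decrease[where a = "\<lambda>l. (norm (x l - s))\<^sup>2"]) (use \<kappa> fejer[OF s] in auto)
  then have "(\<lambda>l. \<kappa> * (norm (E (x l)))\<^sup>2) \<longlonglongrightarrow> 0" by (rule summable_LIMSEQ_zero)
  then have "(\<lambda>l. (norm (E (x l)))\<^sup>2) \<longlonglongrightarrow> 0"
    using \<kappa> tendsto_mult_left_iff[of \<kappa> "\<lambda>l. (norm (E (x l)))\<^sup>2" 0] by simp
  then have res: "(\<lambda>l. E (x l)) \<longlonglongrightarrow> 0"
    using tendsto_real_sqrt by (fastforce simp: tendsto_norm_zero_iff)
  have "\<exists>z\<in>?S. x \<longlonglongrightarrow> z"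
  proof (rule fejer_monotone_converges[OF assms(4)])
    fix z l assume "z \<in> ?S"
    moreover have "0 \<le> \<kappa> * (norm (E (x l)))\<^sup>2" using \<kappa> by simp
    ultimately have "(norm (x (Suc l) - z))\<^sup>2 \<le> (norm (x l - z))\<^sup>2" using fejer[of z l] by linarith
    then show "dist (x (Suc l)) z \<le> dist (x l) z" by (simp add: dist_norm)
  next
    fix r z assume r: "strict_mono r" "(x \<circ> r) \<longlonglongrightarrow> z"
    have "(\<lambda>l. E (x (r l))) \<longlonglongrightarrow> E z"
      using continuous_on_tendsto_compose[OF cont r(2)] by simp
    moreover have "(\<lambda>l. E (x (r l))) \<longlonglongrightarrow> 0"
      using LIMSEQ_subseq_LIMSEQ[OF res r(1)] by (simp add: o_def)
    ultimately show "z \<in> ?S" using LIMSEQ_unique by (auto simp: solution_set_def)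
  qed
  then obtain xs where xs: "xs \<in> ?S" "x \<longlonglongrightarrow> xs" by blast
  have Exs: "E xs = 0" using xs(1) by (simp add: solution_set_def)

  have "(\<lambda>l. infdist (x l) ?S) \<in> o(\<lambda>l. real l powr (- 1 / 2))" if leb: "local_error_bound E"
  proof -
    obtain \<theta> \<delta> where \<theta>: "0 < \<theta>" "0 < \<delta>"
      "\<And>y. infdist y ?S < \<delta> \<Longrightarrow> \<theta> * infdist y ?S \<le> norm (E y)"
      using leb unfolding local_error_bound_def by blast
    have "(\<lambda>l. infdist (x l) ?S) \<longlonglongrightarrow> infdist xs ?S"
      using xs(2) by (rule tendsto_infdist)
    then have "\<forall>\<^sub>F l in sequentially. infdist (x l) ?S < \<delta>"
      using xs(1) \<theta>(2) by (intro order_tendstoD(2)) auto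
    then have "\<forall>\<^sub>F l in sequentially. \<theta> * infdist (x l) ?S \<le> norm (E (x l))"
      by eventually_elim (rule \<theta>(3))
    then obtain l\<^sub>0 q where q: "0 < q" "q < 1"
      "\<And>l. l\<^sub>0 \<le> l \<Longrightarrow> infdist (x l) ?S \<le> infdist (x l\<^sub>0) ?S * q ^ (l - l\<^sub>0)"
      using residual_decrease_geometric[where a = "\<lambda>l. infdist (x l) ?S", OF infdist_nonneg \<kappa> \<theta>(1)
          infdist_fejer_decrease[OF closed assms(4) fejer]] by blast
    have "(\<lambda>l. infdist (x l) ?S) \<in> o(\<lambda>l. 1 / real l)"
      by (rule geometric_bound_smallo_inverse[OF q(1,2), of l\<^sub>0 _ "infdist (x l\<^sub>0) ?S"])
        (use q(3) in \<open>simp add: infdist_nonneg\<close>)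
    then show ?thesis
      using inverse_nat_bigo_powr_minus_half by (rule landau_o.small_big_trans)
  qed
  moreover have "(\<exists>l\<^sub>0 q M. 0 < q \<and> q < 1 \<and> M > 0 \<and>
                  (\<forall>l\<ge>l\<^sub>0. norm (x l - xs) \<le> M * q ^ (l - l\<^sub>0) \<and>
                           norm (E (x l)) \<le> L * M * q ^ (l - l\<^sub>0))) \<and>
               (\<lambda>l. norm (E (x l))) \<in> o(\<lambda>l. 1 / real l)"
    if cd: "continuously_differentiable_near E xs" and sm: "sigma_min (jacobian E (at xs)) > 0"
  proof -
    have "E differentiable (at xs)" using cd unfolding continuously_differentiable_near_def by blast
    then obtain \<theta> where \<theta>: "0 < \<theta>" "\<forall>\<^sub>F y in nhds xs. \<theta> * norm (y - xs) \<le> norm (E y)"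
      using nonsingular_jacobian_error_bound[OF _ sm Exs] by blast
    have "\<forall>\<^sub>F l in sequentially. \<theta> * norm (x l - xs) \<le> norm (E (x l))"
      using \<theta>(2) xs(2) by (rule eventually_compose_filterlim)
    then obtain l\<^sub>0 q where q: "0 < q" "q < 1"
      "\<And>l. l\<^sub>0 \<le> l \<Longrightarrow> norm (x l - xs) \<le> norm (x l\<^sub>0 - xs) * q ^ (l - l\<^sub>0)"
      using residual_decrease_geometric[where a = "\<lambda>l. norm (x l - xs)", OF norm_ge_zero \<kappa> \<theta>(1) fejer[OF xs(1)]] by blast
    define M where "M = norm (x l\<^sub>0 - xs)"
    have "E (x l\<^sub>0) \<noteq> 0" using assms(6) unfolding generated_by_algorithm_def by blast
    then have M: "0 < M" using Exs by (auto simp: M_def)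
    have E: "norm (E (x l)) \<le> L * M * q ^ (l - l\<^sub>0)" if "l\<^sub>0 \<le> l" for l
    proof -
      have "norm (E (x l)) \<le> L * norm (x l - xs)"
        using lipschitz_onD[OF assms(3), of "x l" xs] Exs by (simp add: dist_norm)
      also have "\<dots> \<le> L * (M * q ^ (l - l\<^sub>0))"
        using q(3)[OF that] assms(2) by (simp add: M_def)
      finally show ?thesis by (simp add: mult.assoc)
    qed
    have "(\<lambda>l. norm (E (x l))) \<in> o(\<lambda>l. 1 / real l)"
      by (rule geometric_bound_smallo_inverse[OF q(1,2), of l\<^sub>0 _ "L * M"]) (use E in simp)
    then show ?thesis using q M E unfolding M_def by blast
  qed
  ultimately show ?thesis using xs by blast
qed

end
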